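(* Let $$A=\sum_{n\ge 0}t^n\sum_{\sigma\in\mathcal S_n(123)}y^{\mathrm{des}(\sigma)}x_1^{231\text{-mch}(\sigma)}x_2^{132\text{-mch}(\sigma)}x_3^{321\text{-mch}(\sigma)} ,$$ and let $A_0$ be the formal power series in $t$ (with coefficients in $\mathbb Q[y,x_1,x_2,x_3]$) determined by $$A_0=1+ t x_3 y A_0 + t^2 x_1 y A_0^2 + \frac{ t^3 x_2 x_3 y^2 A_0^3}{1 - t x_3 y A_0}.$$ Then $A=N/D$, where $$D=x_3 (x_1-x_2)\Big(A_0 x_3^2t^2 y^2 (A_0 t^2 y(x_1-x_2)-1)-(A_0+1) x_3 t y(A_0 t^2 y (x_1-x_2)-1)+A_0x_1 t^2 y-1\Big)$$ and $$\begin{aligned} N={}&x_1 \Big(x_3^2 t y \big(A_0^2 t^2(x_2 t^2 y^2+y (3 x_2 t+2x_2+t+1)+1)+A_0 ((x_2+1) t^3 y+t^2 (2x_2 y+y+2)+t+1)+t+1\big)\\ &\quad+x_2 t^2 (-A_0^2t y+A_0-1)+A_0^2 x_3^4 t^5 y^3\\ &\quad-A_0x_3^3 t^2 y^2 \big(A_0 (x_2+1) t^3 y+t^2 (A_0(2 x_2 y+y+2)+1)+t+1\big)\\ &\quad+x_3 \big(A_0 x_2t^4 y (A_0-y)-A_0 t^3 y (A_0x_2+x_2+1)-A_0 t^2 (x_2y+y+1)-t-1\big)\Big)\\ &+x_2 \Big(-A_0^2 x_3^4 t^5y^3-x_3^2 t y \big(A_0^2 (2 t-1) t^2 y+A_0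 (t^3y+t^2 (y+2)+t+1)+t+1\big)\\ &\quad+x_3 \big(t^2 (-A_0^2y+y+1)+A_0 (A_0+1) t^3 y+t+1\big)\\ &\quad+A_0x_3^3 t^2 y^2 \big(A_0 t^3 y+(A_0+1)t^2+t+1\big)+(A_0-1) t\Big)\\ &+x_3 t (x_3 t y-1)\big(A_0^2 x_3 t y (x_3 ty-1)+A_0-1\big)\\ &+A_0 x_1^2 t^2 y \big(-A_0x_2 t^2+A_0 x_3^3 t^2 y^2-(A_0+1) x_3^2 ty+x_3\big)\\ &+A_0 x_2^2 x_3 t^3 y\big(A_0 x_3^2 t (t+1) y^2-x_3 y (A_0 t^2y+2 A_0 t+A_0+t+1)+(A_0+1) ty+1\big). \end{aligned}$$
   Context: $\mathcal S_n$ is the set of permutations of $\{1,\dots,n\}$ in one-line notation ($\mathcal S_0$ contains only the empty permutation, on which all statistics are $0$). For a word $w$ of distinct integers, $\mathrm{red}(w)$ replaces the $i$-th smallest letter by $i$. $\sigma\in\mathcal S_n$ avoids $\lambda\in\mathcal S_k$ (classical avoidance) if no (not necessarily contiguous) subsequence $\sigma_{i_1}\cdots\sigma_{i_k}$, $i_1<\dots<i_k$, has reduction $\lambda$; $\mathcal S_n(\lambda)$ is the set of such $\sigma$. $\gamma\text{-mch}(\sigma)$ is the number of $i$ with $\mathrm{red}(\sigma_i\sigma_{i+1}\cdots\sigma_{i+k-1})=\gamma$ for $\gamma\in\mathcal S_k$. $\mathrm{des}(\sigma)=|\{i:\sigma_i>\sigma_{i+1}\}|$. The identity $A=N/D$ is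 in the fraction field of $\mathbb Q[y,x_1,x_2,x_3][[t]]$. *)

theory Defs
  imports
    "HOL-Computational_Algebra.Computational_Algebra"
    "HOL-Combinatorics.Multiset_Permutations"
    "HOL-Library.Sublist"
begin

section \<open>Permutations in one-line notation\<close>

text \<open>A permutation of \<open>{1..n}\<close> is an element of \<open>permutations_of_set {1..n}\<close>, i.e. the list
  of its values; list positions are 0-based, the letters are 1-based.\<close>

definition red :: "nat list \<Rightarrow> nat list" where
  "red w = map (\<lambda>a. card {b \<in> set w. b \<le> a}) w"

definition avoids :: "nat list \<Rightarrow> nat list \<Rightarrow> bool" where
  "avoids \<sigma> pat \<longleftrightarrow> (\<nexists>w. subseq w \<sigma> \<and> red w = pat)"

definition avoiders :: "nat \<Rightarrow> nat list \<Rightarrow> nat list set" where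
  "avoiders n pat = {\<sigma> \<in> permutations_of_set {1..n}. avoids \<sigma> pat}"

definition mch :: "nat list \<Rightarrow> nat list \<Rightarrow> nat" where
  "mch \<gamma> \<sigma> = card {i. i + length \<gamma> \<le> length \<sigma> \<and> red (take (length \<gamma>) (drop i \<sigma>)) = \<gamma>}"

definition des :: "nat list \<Rightarrow> nat" where
  "des \<sigma> = card {i. Suc i < length \<sigma> \<and> \<sigma> ! i > \<sigma> ! Suc i}"


section \<open>The coefficient ring and the generating function\<close>

text \<open>\<open>\<rat>[y, x\<^sub>1, x\<^sub>2, x\<^sub>3]\<close> is represented as the iterated polynomial ring
  \<open>\<rat>[y][x\<^sub>1][x\<^sub>2][x\<^sub>3]\<close>, so that \<open>y\<close> is the innermost indeterminate.\<close>

type_synonym coeffs = "rat poly poly poly poly"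

definition vy :: coeffs where "vy = [:[:[:[:0, 1:]:]:]:]"
definition vx1 :: coeffs where "vx1 = [:[:[:0, 1:]:]:]"
definition vx2 :: coeffs where "vx2 = [:[:0, 1:]:]"
definition vx3 :: coeffs where "vx3 = [:0, 1:]"

definition A_series :: "coeffs fps" where
  "A_series = Abs_fps (\<lambda>n. \<Sum>\<sigma>\<in>avoiders n [1,2,3].
     vy ^ des \<sigma> * vx1 ^ mch [2,3,1] \<sigma> * vx2 ^ mch [1,3,2] \<sigma> * vx3 ^ mch [3,2,1] \<sigma>)"


section \<open>The auxiliary series\<close>

abbreviation Y :: "coeffs fps" where "Y \<equiv> fps_const vy"
abbreviation X1 :: "coeffs fps" where "X1 \<equiv> fps_const vx1"
abbreviation X2 :: "coeffs fps" where "X2 \<equiv> fps_const vx2"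
abbreviation X3 :: "coeffs fps" where "X3 \<equiv> fps_const vx3"
abbreviation T :: "coeffs fps" where "T \<equiv> fps_X"

text \<open>The library has no division on \<open>coeffs fps\<close>, because \<open>coeffs\<close> is not a field; the quotient
  is therefore taken in the fraction field. Its denominator has constant term \<open>1\<close>.\<close>

definition A0_equation :: "coeffs fps \<Rightarrow> bool" where
  "A0_equation F \<longleftrightarrow>
     to_fract F = to_fract (1 + T * X3 * Y * F + T^2 * X1 * Y * F^2)
       + to_fract (T^3 * X2 * X3 * Y^2 * F^3) / to_fract (1 - T * X3 * Y * F)"

definition A0 :: "coeffs fps" where
  "A0 = (THE F. A0_equation F)"

text \<open>The equation determines \<open>A0\<close>: it is the fixed point equation of a map that is contracting
  in the \<open>T\<close>-adic sense.\<close>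

definition agree :: "nat \<Rightarrow> 'a::comm_ring_1 fps \<Rightarrow> 'a fps \<Rightarrow> bool" where
  "agree n f g \<longleftrightarrow> (\<forall>i<n. f $ i = g $ i)"

lemma agree_refl: "agree n f f"
  by (simp add: agree_def)

lemma agree_add: "agree n f g \<Longrightarrow> agree n f' g' \<Longrightarrow> agree n (f + f') (g + g')"
  by (simp add: agree_def)

lemma agree_diff: "agree n f g \<Longrightarrow> agree n f' g' \<Longrightarrow> agree n (f - f') (g - g')"
  by (simp add: agree_def)

lemma agree_mult: "agree n f g \<Longrightarrow> agree n f' g' \<Longrightarrow> agree n (f * f') (g * g')"
  by (auto simp: agree_def fps_mult_nth intro!: sum.cong)

lemma agree_power: "agree n f g \<Longrightarrow> agree n (f ^ k) (g ^ k)"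
  by (induction k) (auto intro: agree_refl agree_mult)

lemma agree_X_mult: "agree n f g \<Longrightarrow> agree (Suc n) (fps_X * f) (fps_X * g)"
  by (auto simp: agree_def)

definition geom :: "coeffs fps \<Rightarrow> coeffs fps" where
  "geom F = fps_right_inverse (1 - T * X3 * Y * F) 1"

lemma geom: "(1 - T * X3 * Y * F) * geom F = 1"
  unfolding geom_def by (rule fps_right_inverse) simp

lemma agree_geom:
  assumes "agree n F G"
  shows "agree n (geom F) (geom G)"
proof -
  have "agree n (geom F * (1 - T * X3 * Y * G) * geom G) (geom F * (1 - T * X3 * Y * F) * geom G)"
    using assms by (intro agree_mult agree_diff agree_refl) (simp add: agree_def)
  moreover have "geom F * (1 - T * X3 * Y * G) * geom G = geom F"
    using geom[of G] by (metis mult.assoc mult.right_neutral)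
  moreover have "geom F * (1 - T * X3 * Y * F) * geom G = geom G"
    using geom[of F] by (metis mult.commute mult.right_neutral)
  ultimately show ?thesis by simp
qed

definition step :: "coeffs fps \<Rightarrow> coeffs fps" where
  "step F = 1 + T * (X3 * Y * F + T * X1 * Y * F^2 + T^2 * X2 * X3 * Y^2 * F^3 * geom F)"

lemma agree_step: "agree n F G \<Longrightarrow> agree (Suc n) (step F) (step G)"
  unfolding step_def
  by (intro agree_add agree_refl agree_X_mult agree_mult agree_power agree_geom)

lemma A0_equation_iff: "A0_equation F \<longleftrightarrow> F = step F"
proof -
  let ?d = "1 - T * X3 * Y * F"
  have "to_fract ?d * to_fract (geom F) = 1"
    using geom[of F] by (simp only: to_fract_1 flip: to_fract_mult)
  hence "inverse (to_fract ?d) = to_fract (geom F)"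
    by (rule inverse_unique)
  hence "to_fract (T^3 * X2 * X3 * Y^2 * F^3) / to_fract ?d
      = to_fract (T^3 * X2 * X3 * Y^2 * F^3 * geom F)"
    by (simp only: divide_inverse to_fract_mult)
  hence "A0_equation F \<longleftrightarrow>
      to_fract F = to_fract (1 + T * X3 * Y * F + T^2 * X1 * Y * F^2
        + T^3 * X2 * X3 * Y^2 * F^3 * geom F)"
    unfolding A0_equation_def by (simp only: to_fract_add)
  moreover have "1 + T * X3 * Y * F + T^2 * X1 * Y * F^2
        + T^3 * X2 * X3 * Y^2 * F^3 * geom F = step F"
    unfolding step_def by (simp only: distrib_left power2_eq_square power3_eq_cube mult.assoc add.assoc)
  ultimately show ?thesis
    by (simp only: to_fract_eq_iff)
qed

lemma A0_unique_existence: "\<exists>!F. A0_equation F"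
proof -
  define S where "S = (\<lambda>n. (step ^^ n) 0)"
  define F where "F = Abs_fps (\<lambda>n. S (Suc n) $ n)"
  have S_agree: "agree n (S n) (S (n + k))" for n k
  proof (induction n)
    case (Suc n)
    show ?case using agree_step[OF Suc] by (simp add: S_def)
  qed (simp add: agree_def)
  have F_agree: "agree n F (S n)" for n
    unfolding agree_def
  proof (intro allI impI)
    fix i assume "i < n"
    then obtain k where "n = Suc i + k" by (metis Suc_leI le_Suc_ex)
    thus "F $ i = S n $ i"
      using S_agree[of "Suc i" k] by (simp add: F_def agree_def)
  qed
  have "step F $ n = F $ n" for n
    using agree_step[OF F_agree[of n]] F_agree[of "Suc n"] by (simp add: agree_def S_def)
  hence "F = step F" by (simp add: fps_eq_iff)
  moreover have "G = F" if "G = step G" for G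
  proof -
    have "agree n G F" for n
      by (induction n) (simp add: agree_def, metis agree_step that \<open>F = step F\<close>)
    thus ?thesis by (auto simp: fps_eq_iff agree_def)
  qed
  ultimately show ?thesis unfolding A0_equation_iff by blast
qed

lemma A0_equation_A0: "A0_equation A0"
  unfolding A0_def using A0_unique_existence by (rule theI')


section \<open>Numerator and denominator\<close>

definition D_expr :: "'a::comm_ring_1 \<Rightarrow> 'a \<Rightarrow> 'a \<Rightarrow> 'a \<Rightarrow> 'a \<Rightarrow> 'a \<Rightarrow> 'a" where
  "D_expr x\<^sub>1 x\<^sub>2 x\<^sub>3 y t A\<^sub>0 =
     x\<^sub>3 * (x\<^sub>1 - x\<^sub>2) *
       (A\<^sub>0 * x\<^sub>3^2 * t^2 * y^2 * (A\<^sub>0 * t^2 * y * (x\<^sub>1 - x\<^sub>2) - 1)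
        - (A\<^sub>0 + 1) * x\<^sub>3 * t * y * (A\<^sub>0 * t^2 * y * (x\<^sub>1 - x\<^sub>2) - 1)
        + A\<^sub>0 * x\<^sub>1 * t^2 * y - 1)"

definition N_expr :: "'a::comm_ring_1 \<Rightarrow> 'a \<Rightarrow> 'a \<Rightarrow> 'a \<Rightarrow> 'a \<Rightarrow> 'a \<Rightarrow> 'a" where
  "N_expr x\<^sub>1 x\<^sub>2 x\<^sub>3 y t A\<^sub>0 =
     x\<^sub>1 *
       (x\<^sub>3^2 * t * y *
          (A\<^sub>0^2 * t^2 * (x\<^sub>2 * t^2 * y^2 + y * (3 * x\<^sub>2 * t + 2 * x\<^sub>2 + t + 1) + 1)
           + A\<^sub>0 * ((x\<^sub>2 + 1) * t^3 * y + t^2 * (2 * x\<^sub>2 * y + y + 2) + t + 1)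
           + t + 1)
        + x\<^sub>2 * t^2 * (- (A\<^sub>0^2) * t * y + A\<^sub>0 - 1)
        + A\<^sub>0^2 * x\<^sub>3^4 * t^5 * y^3
        - A\<^sub>0 * x\<^sub>3^3 * t^2 * y^2 *
            (A\<^sub>0 * (x\<^sub>2 + 1) * t^3 * y + t^2 * (A\<^sub>0 * (2 * x\<^sub>2 * y + y + 2) + 1) + t + 1)
        + x\<^sub>3 *
            (A\<^sub>0 * x\<^sub>2 * t^4 * y * (A\<^sub>0 - y) - A\<^sub>0 * t^3 * y * (A\<^sub>0 * x\<^sub>2 + x\<^sub>2 + 1)
             - A\<^sub>0 * t^2 * (x\<^sub>2 * y + y + 1) - t - 1))
     + x\<^sub>2 *
       (- (A\<^sub>0^2) * x\<^sub>3^4 * t^5 * y^3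
        - x\<^sub>3^2 * t * y *
            (A\<^sub>0^2 * (2 * t - 1) * t^2 * y + A\<^sub>0 * (t^3 * y + t^2 * (y + 2) + t + 1) + t + 1)
        + x\<^sub>3 * (t^2 * (- (A\<^sub>0^2) * y + y + 1) + A\<^sub>0 * (A\<^sub>0 + 1) * t^3 * y + t + 1)
        + A\<^sub>0 * x\<^sub>3^3 * t^2 * y^2 * (A\<^sub>0 * t^3 * y + (A\<^sub>0 + 1) * t^2 + t + 1)
        + (A\<^sub>0 - 1) * t)
     + x\<^sub>3 * t * (x\<^sub>3 * t * y - 1) * (A\<^sub>0^2 * x\<^sub>3 * t * y * (x\<^sub>3 * t * y - 1) + A\<^sub>0 - 1)
     + A\<^sub>0 * x\<^sub>1^2 * t^2 * y *
         (- A\<^sub>0 * x\<^sub>2 * t^2 + A\<^sub>0 * x\<^sub>3^3 * t^2 * y^2 - (A\<^sub>0 + 1) * x\<^sub>3^2 * t * y + x\<^sub>3)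
     + A\<^sub>0 * x\<^sub>2^2 * x\<^sub>3 * t^3 * y *
         (A\<^sub>0 * x\<^sub>3^2 * t * (t + 1) * y^2
          - x\<^sub>3 * y * (A\<^sub>0 * t^2 * y + 2 * A\<^sub>0 * t + A\<^sub>0 + t + 1)
          + (A\<^sub>0 + 1) * t * y + 1)"

end

theory Submission
  imports Defs
begin

text \<open>Every \<open>123\<close>-avoider of size \<open>n + 1\<close> arises from a unique one, \<open>\<tau>\<close>, of size \<open>n\<close> by prepending a
  letter \<open>a\<close> that is larger than \<open>asc_bot \<tau>\<close>, the largest letter that starts an increasing pair (or \<open>0\<close>);
  so the number of choices is governed by the label \<open>k = n - asc_bot \<tau>\<close>. The change of the weight
  depends only on whether \<open>\<tau>\<close> and its tail begin with their largest letters and on whether \<open>a\<close> is \<open>n + 1\<close>, \<open>n\<close> or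
  smaller. This gives linear equations for the series that weight a permutation by \<open>f k\<close>. For \<open>f k = u ^ k\<close>
  they are solved by the kernel method, and the kernel vanishes at \<open>u = A0\<close>. Together with the equations for
  \<open>f = 1\<close> and \<open>f k = k\<close> this determines \<open>A_series\<close> rationally in terms of \<open>A0\<close>.\<close>

text \<open>Keeps the pattern \<open>[1, 2, 3]\<close> in the form in which it occurs in \<open>A_series_def\<close>.\<close>

declare One_nat_def [simp del]

section \<open>Patterns, descents and weights under relabelling and prepending\<close>

lemma red_map_strict_mono:
  assumes "strict_mono f"
  shows "red (map f w) = red w"
proof -
  have "{b \<in> f ` set w. b \<le> f x} = f ` {b \<in> set w. b \<le> x}" for x
    using assms by (auto simp: strict_mono_less_eq)
  moreover have "inj_on f S" for S
    using assms by (meson inj_on_subset strict_mono_imp_inj_on subset_UNIV)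
  ultimately show ?thesis
    by (simp add: red_def card_image)
qed

lemma Collect_insert_and:
  "{z \<in> insert a B. P z} = (if P a then insert a {z \<in> B. P z} else {z \<in> B. P z})"
  by auto

lemma red_eq_patterns:
  "red [a, b, c] = [1, 2, 3] \<longleftrightarrow> a < b \<and> b < c"
  "red [a, b, c] = [2, 3, 1] \<longleftrightarrow> c < a \<and> a < b"
  "red [a, b, c] = [1, 3, 2] \<longleftrightarrow> a < c \<and> c < b"
  "red [a, b, c] = [3, 2, 1] \<longleftrightarrow> c < b \<and> b < a"
  unfolding red_def list.set list.map Collect_insert_and by (auto simp: card_insert_if)

lemma length_red [simp]: "length (red w) = length w"
  by (simp add: red_def)

lemma mch_map_strict_mono: "strict_mono f \<Longrightarrow> mch \<gamma> (map f \<sigma>) = mch \<gamma> \<sigma>"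
  by (simp add: mch_def drop_map take_map red_map_strict_mono)

lemma des_map_strict_mono:
  assumes "strict_mono f"
  shows "des (map f \<sigma>) = des \<sigma>"
  unfolding des_def using assms
  by (intro arg_cong[where f = card]) (auto simp: strict_mono_less)

lemma card_Collect_nat_Suc:
  assumes "finite {i. P (Suc i)}"
  shows "card {i. P i} = of_bool (P 0) + card {i. P (Suc i)}"
proof -
  have "{i. P i} = {i. i = 0 \<and> P 0} \<union> Suc ` {i. P (Suc i)}"
  proof (intro set_eqI)
    fix i show "i \<in> {i. P i} \<longleftrightarrow> i \<in> {i. i = 0 \<and> P 0} \<union> Suc ` {i. P (Suc i)}"
      by (cases i) auto
  qed
  also have "card \<dots> = card {i::nat. i = 0 \<and> P 0} + card (Suc ` {i. P (Suc i)})"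
    by (rule card_Un_disjoint) (use assms in auto)
  finally show ?thesis by (simp add: card_image)
qed

lemma mch_Cons:
  "mch \<gamma> (a # xs) = of_bool (length \<gamma> \<le> Suc (length xs) \<and> red (take (length \<gamma>) (a # xs)) = \<gamma>)
     + mch \<gamma> xs"
proof -
  have "finite {i. i + length \<gamma> \<le> length xs \<and> red (take (length \<gamma>) (drop i xs)) = \<gamma>}"
    by (rule finite_subset[of _ "{..length xs}"]) auto
  thus ?thesis
    unfolding mch_def by (subst card_Collect_nat_Suc) simp_all
qed

lemma des_Cons: "des (a # b # xs) = of_bool (b < a) + des (b # xs)"
proof -
  have "finite {i. Suc i < length (b # xs) \<and> (b # xs) ! Suc i < (b # xs) ! i}"
    by (rule finite_subset[of _ "{..length xs}"]) auto
  thus ?thesis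
    unfolding des_def by (subst card_Collect_nat_Suc) simp_all
qed

definition wt :: "nat list \<Rightarrow> coeffs" where
  "wt \<sigma> = vy ^ des \<sigma> * vx1 ^ mch [2,3,1] \<sigma> * vx2 ^ mch [1,3,2] \<sigma> * vx3 ^ mch [3,2,1] \<sigma>"

lemma wt_map_strict_mono: "strict_mono f \<Longrightarrow> wt (map f \<sigma>) = wt \<sigma>"
  by (simp add: wt_def mch_map_strict_mono des_map_strict_mono)

lemma wt_Nil [simp]: "wt [] = 1"
  by (simp add: wt_def mch_def des_def)

lemma wt_single [simp]: "wt [a] = 1"
  by (simp add: wt_def mch_def des_def)

lemma wt_pair: "wt [a, b] = (if b < a then vy else 1)"
proof -
  have "des [b] = 0" by (simp add: des_def)
  moreover have "mch \<gamma> [a, b] = 0" if "length \<gamma> = 3" for \<gamma>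
    using that by (simp add: mch_def)
  ultimately show ?thesis by (simp add: wt_def des_Cons)
qed

lemma wt_Cons:
  "wt (a # b # c # xs) =
     (if b < a then vy else 1) * (if c < a \<and> a < b then vx1 else 1) *
     (if a < c \<and> c < b then vx2 else 1) * (if c < b \<and> b < a then vx3 else 1) * wt (b # c # xs)"
  unfolding wt_def des_Cons mch_Cons[of _ a "b # c # xs"]
  by (simp add: red_eq_patterns[simplified] power_add)

section \<open>Increasing pairs and avoidance of 123\<close>

fun asc_bot :: "nat list \<Rightarrow> nat" where
  "asc_bot [] = 0"
| "asc_bot (x # xs) = (if \<exists>y\<in>set xs. x < y then max x (asc_bot xs) else asc_bot xs)"

lemma subseq_pair_Cons:
  "subseq [b, c] (x # xs) \<longleftrightarrow> b = x \<and> c \<in> set xs \<or> subseq [b, c] xs"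
  by (auto simp: subseq_singleton_left subseq_Cons2_iff dest: subseq_Cons')

lemma subseq_triple_Cons:
  "subseq [a, b, c] (x # xs) \<longleftrightarrow> a = x \<and> subseq [b, c] xs \<or> subseq [a, b, c] xs"
  by (auto simp: subseq_Cons2_iff dest: subseq_Cons')

lemma less_bot_iff: "x < asc_bot xs \<longleftrightarrow> (\<exists>b c. subseq [b, c] xs \<and> x < b \<and> b < c)"
proof (induction xs)
  case (Cons a xs)
  have "(\<exists>b c. subseq [b, c] (a # xs) \<and> x < b \<and> b < c) \<longleftrightarrow>
      x < a \<and> (\<exists>c\<in>set xs. a < c) \<or> x < asc_bot xs"
    unfolding subseq_pair_Cons Cons.IH by blast
  thus ?case by (auto simp: less_max_iff_disj)
qed simp

lemma avoids_123_iff: "avoids \<sigma> [1,2,3] \<longleftrightarrow> \<not> (\<exists>a b c. subseq [a, b, c] \<sigma> \<and> a < b \<and> b < c)"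
proof -
  have "red w = [1,2,3] \<longleftrightarrow> (\<exists>a b c. w = [a, b, c] \<and> a < b \<and> b < c)" for w
  proof
    assume *: "red w = [1,2,3]"
    hence "length w = 3" by (metis length_red length_Cons list.size(3) numeral_3_eq_3)
    then obtain a b c where "w = [a, b, c]"
      by (auto simp: numeral_3_eq_3 length_Suc_conv)
    thus "\<exists>a b c. w = [a, b, c] \<and> a < b \<and> b < c" using * red_eq_patterns(1) by blast
  qed (use red_eq_patterns(1) in blast)
  thus ?thesis by (simp only: avoids_def) blast
qed

lemma avoids_123_Nil: "avoids [] [1,2,3]"
  unfolding avoids_123_iff by simp

text \<open>A new first letter can only play the smallest letter of an occurrence of 123, so the
  only obstruction is an increasing pair of \<open>xs\<close> lying above it.\<close>

lemma avoids_123_Cons: "avoids (x # xs) [1,2,3] \<longleftrightarrow> asc_bot xs \<le> x \<and> avoids xs [1,2,3]"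
proof -
  have "asc_bot xs \<le> x \<longleftrightarrow> \<not> (\<exists>b c. subseq [b, c] xs \<and> x < b \<and> b < c)"
    unfolding less_bot_iff[symmetric] by (rule not_less[symmetric])
  thus ?thesis unfolding avoids_123_iff subseq_triple_Cons by blast
qed

lemma asc_bot_map:
  assumes "strict_mono f" "f 0 = 0"
  shows "asc_bot (map f xs) = f (asc_bot xs)"
  using assms by (induction xs) (auto simp: strict_mono_less max_of_mono strict_mono_mono)

lemma avoids_123_map:
  assumes "strict_mono f" "f 0 = 0"
  shows "avoids (map f xs) [1,2,3] \<longleftrightarrow> avoids xs [1,2,3]"
  using assms by (induction xs) (auto simp: avoids_123_Nil avoids_123_Cons asc_bot_map strict_mono_less_eq)

text \<open>\<open>asc_bot xs\<close> is 0 or the lower letter of an increasing pair; either way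
  some letter exceeds it. This makes the labels of nonempty avoiders positive.\<close>

lemma asc_bot_less_some: "xs \<noteq> [] \<Longrightarrow> \<forall>x\<in>set xs. 0 < x \<Longrightarrow> \<exists>y\<in>set xs. asc_bot xs < y"
proof (induction xs)
  case (Cons x xs)
  thus ?case by (cases "xs = []") (auto simp: max_def)
qed simp

section \<open>Generating avoiders by prepending a letter\<close>

definition shift :: "nat \<Rightarrow> nat \<Rightarrow> nat" where
  "shift a x = (if x < a then x else Suc x)"

text \<open>\<open>shift a\<close> opens a gap at the value \<open>a\<close>, so
  \<open>ins a\<close> inverts deleting the first letter \<open>a\<close> and standardising the
  rest.\<close>

definition ins :: "nat \<Rightarrow> nat list \<Rightarrow> nat list" where
  "ins a \<tau> = a # map (shift a) \<tau>"

lemma strict_mono_shift: "strict_mono (shift a)"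
  by (auto simp: strict_mono_def shift_def)

lemma shift_0: "0 < a \<Longrightarrow> shift a 0 = 0"
  by (simp add: shift_def)

lemma shift_le_iff: "shift a x \<le> a \<longleftrightarrow> x < a"
  by (auto simp: shift_def)

lemma shift_image:
  assumes "a \<in> {1..Suc n}"
  shows "shift a ` {1..n} = {1..Suc n} - {a}"
proof (intro subset_antisym image_subsetI subsetI)
  fix x assume "x \<in> {1..Suc n} - {a}"
  hence "x = shift a (if x < a then x else x - 1)" "(if x < a then x else x - 1) \<in> {1..n}"
    using assms by (auto simp: shift_def)
  thus "x \<in> shift a ` {1..n}" by (rule image_eqI)
qed (use assms in \<open>auto simp: shift_def\<close>)

abbreviation av :: "nat \<Rightarrow> nat list set" where "av n \<equiv> avoiders n [1,2,3]"

lemma avD: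
  assumes "\<tau> \<in> av n"
  shows "set \<tau> = {1..n}" "distinct \<tau>" "length \<tau> = n" "avoids \<tau> [1,2,3]"
  using assms by (auto simp: avoiders_def permutations_of_set_def length_finite_permutations_of_set
      dest: distinct_card)

lemma finite_av: "finite (av n)"
  by (simp add: avoiders_def)

lemma av_0: "av 0 = {[]}"
  using avoids_123_Nil by (auto simp: avoiders_def)

text \<open>\<open>shift a\<close> is strictly increasing and fixes 0, so it preserves avoidance and
  commutes with \<open>asc_bot\<close>. The bound for prepending becomes strict because
  \<open>shift a x \<le> a\<close> means \<open>x < a\<close>.\<close>

lemma ins_in_av_iff:
  assumes "a \<in> {1..Suc n}" "\<tau> \<in> permutations_of_set {1..n}"
  shows "ins a \<tau> \<in> av (Suc n) \<longleftrightarrow> \<tau> \<in> av n \<and> asc_bot \<tau> < a"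
proof -
  have "set (ins a \<tau>) = {1..Suc n}" "distinct (ins a \<tau>)"
    using assms shift_image[OF assms(1)] strict_mono_imp_inj_on[OF strict_mono_shift]
    by (auto simp: ins_def permutations_of_set_def distinct_map intro: inj_on_subset)
  moreover have "avoids (ins a \<tau>) [1,2,3] \<longleftrightarrow> asc_bot \<tau> < a \<and> avoids \<tau> [1,2,3]"
    using assms(1) unfolding ins_def avoids_123_Cons
    by (subst avoids_123_map asc_bot_map; simp add: strict_mono_shift shift_0 shift_le_iff)+
  ultimately show ?thesis
    using assms by (auto simp: avoiders_def permutations_of_set_def)
qed

lemma ins_surj:
  assumes "\<sigma> \<in> av (Suc n)"
  obtains a \<tau> where "a \<in> {1..Suc n}" "\<tau> \<in> permutations_of_set {1..n}" "\<sigma> = ins a \<tau>"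
proof -
  obtain a xs where \<sigma>: "\<sigma> = a # xs" using avD(3)[OF assms] by (cases \<sigma>) auto
  have a: "a \<in> {1..Suc n}" and xs: "set xs = {1..Suc n} - {a}" "distinct xs"
    using avD(1,2)[OF assms] by (auto simp: \<sigma>)
  have inj: "inj (shift a)" by (rule strict_mono_imp_inj_on[OF strict_mono_shift])
  define \<tau> where "\<tau> = map (the_inv (shift a)) xs"
  have "x \<in> range (shift a)" if "x \<in> set xs" for x
    using that xs(1) shift_image[OF a] by blast
  hence xs_eq: "map (shift a) \<tau> = xs"
    unfolding \<tau>_def map_map by (intro map_idI) (simp add: f_the_inv_into_f[OF inj])
  hence "shift a ` set \<tau> = shift a ` {1..n}"
    using xs shift_image[OF a] by (metis set_map)
  hence "set \<tau> = {1..n}" by (simp only: inj_image_eq_iff[OF inj])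
  moreover have "distinct \<tau>" using xs_eq xs(2) distinct_map by blast
  ultimately show ?thesis using that[OF a, of \<tau>] xs_eq \<sigma>
    by (simp add: ins_def permutations_of_set_def)
qed

lemma ins_inj: "ins a \<tau> = ins a' \<tau>' \<longleftrightarrow> a = a' \<and> \<tau> = \<tau>'"
  using inj_map_eq_map[OF strict_mono_imp_inj_on[OF strict_mono_shift]] by (auto simp: ins_def)

text \<open>The generating tree: \<open>ins\<close> is a bijection from pairs of an avoider and an
  admissible first letter onto the avoiders of the next size.\<close>

lemma sum_av_Suc:
  "(\<Sum>\<sigma>\<in>av (Suc n). g \<sigma>) = (\<Sum>\<tau>\<in>av n. \<Sum>a\<in>{asc_bot \<tau><..Suc n}. g (ins a \<tau>))"
proof -
  have "bij_betw (\<lambda>(\<tau>, a). ins a \<tau>) (SIGMA \<tau>:av n. {asc_bot \<tau><..Suc n}) (av (Suc n))"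
  proof (rule bij_betw_imageI)
    show "inj_on (\<lambda>(\<tau>, a). ins a \<tau>) (SIGMA \<tau>:av n. {asc_bot \<tau><..Suc n})"
      by (auto simp: inj_on_def ins_inj)
    have "(case x of (\<tau>, a) \<Rightarrow> ins a \<tau>) \<in> av (Suc n)" if "x \<in> (SIGMA \<tau>:av n. {asc_bot \<tau><..Suc n})" for x
      using that by (auto simp: ins_in_av_iff avoiders_def[of n])
    moreover have "\<exists>x \<in> (SIGMA \<tau>:av n. {asc_bot \<tau><..Suc n}). \<sigma> = (case x of (\<tau>, a) \<Rightarrow> ins a \<tau>)"
      if \<sigma>: "\<sigma> \<in> av (Suc n)" for \<sigma>
    proof -
      obtain a \<tau> where *: "a \<in> {1..Suc n}" "\<tau> \<in> permutations_of_set {1..n}" "\<sigma> = ins a \<tau>"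
        using ins_surj[OF \<sigma>] .
      hence "\<tau> \<in> av n \<and> asc_bot \<tau> < a" using \<sigma> ins_in_av_iff by blast
      thus ?thesis using * by (intro bexI[of _ "(\<tau>, a)"]) auto
    qed
    ultimately show "(\<lambda>(\<tau>, a). ins a \<tau>) ` (SIGMA \<tau>:av n. {asc_bot \<tau><..Suc n}) = av (Suc n)"
      by fast
  qed
  from sum.reindex_bij_betw[OF this, of g, symmetric] show ?thesis
    by (simp add: sum.Sigma finite_av case_prod_beta)
qed

section \<open>Leading maxima and the change of label and weight\<close>

definition top_first :: "nat list \<Rightarrow> bool" where
  "top_first xs \<longleftrightarrow> (\<forall>z\<in>set (tl xs). z < hd xs)"

text \<open>The memory of the recursion: these two bits determine how the first two letters compare
  with each other. Since \<open>tl []\<close> is \<open>[]\<close>, lists of at most one letter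
  satisfy \<open>top_first\<close>.\<close>

definition kind :: "nat list \<Rightarrow> bool \<times> bool" where
  "kind \<sigma> = (top_first \<sigma>, top_first (tl \<sigma>))"

text \<open>The first letter is below a later one, so it starts an increasing pair; avoidance
  forbids a higher start further right.\<close>

lemma asc_bot_not_top_first:
  assumes "avoids (x # xs) [1,2,3]" "distinct (x # xs)" "\<not> top_first (x # xs)"
  shows "asc_bot (x # xs) = x"
proof -
  from assms(2,3) obtain y where "y \<in> set xs" "x < y"
    by (auto simp: top_first_def) (metis nat_neq_iff)
  thus ?thesis using assms(1) by (auto simp: avoids_123_Cons max_def)
qed

lemma asc_bot_top_first: "top_first (x # xs) \<Longrightarrow> asc_bot (x # xs) = asc_bot xs"
  by (auto simp: top_first_def)

lemma top_first_map: "strict_mono f \<Longrightarrow> top_first (map f xs) = top_first xs"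
  by (cases xs) (auto simp: top_first_def strict_mono_less)

lemma top_first_ins:
  assumes "\<tau> \<in> av n" "a \<in> {1..Suc n}"
  shows "top_first (ins a \<tau>) \<longleftrightarrow> a = Suc n"
proof -
  have "set (map (shift a) \<tau>) = {1..Suc n} - {a}"
    using shift_image[OF assms(2)] avD(1)[OF assms(1)] by simp
  hence "top_first (ins a \<tau>) \<longleftrightarrow> (\<forall>z\<in>{1..Suc n} - {a}. z < a)"
    unfolding top_first_def ins_def by simp
  also have "\<dots> \<longleftrightarrow> a = Suc n"
  proof
    assume *: "\<forall>z\<in>{1..Suc n} - {a}. z < a"
    show "a = Suc n"
    proof (rule ccontr)
      assume "a \<noteq> Suc n"
      hence "Suc n \<in> {1..Suc n} - {a}" by simp
      hence "Suc n < a" using * by blast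
      thus False using assms(2) by simp
    qed
  qed auto
  finally show ?thesis .
qed

lemma kind_ins:
  assumes "\<tau> \<in> av n" "a \<in> {1..Suc n}"
  shows "kind (ins a \<tau>) = (a = Suc n, top_first \<tau>)"
  using top_first_ins[OF assms] by (simp add: kind_def ins_def top_first_map strict_mono_shift)

lemma asc_bot_less: "\<tau> \<in> av n \<Longrightarrow> 0 < n \<Longrightarrow> asc_bot \<tau> < n"
  using asc_bot_less_some[of \<tau>] avD[of \<tau> n] by fastforce

lemma asc_bot_le: "\<tau> \<in> av n \<Longrightarrow> asc_bot \<tau> \<le> n"
  using asc_bot_less[of \<tau> n] by (cases "n = 0") (auto simp: av_0)

text \<open>In terms of labels, a parent with label \<open>k\<close> has one child with label
  \<open>k + 1\<close>, from the new maximum, and one child for each label in \<open>1..k\<close>,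
  since any other \<open>a\<close> becomes the new bottom.\<close>

lemma asc_bot_ins:
  assumes "\<tau> \<in> av n" "a \<in> {asc_bot \<tau><..Suc n}"
  shows "asc_bot (ins a \<tau>) = (if a = Suc n then asc_bot \<tau> else a)"
proof -
  have a: "a \<in> {1..Suc n}" and less: "asc_bot \<tau> < a" using assms(2) by auto
  have "ins a \<tau> \<in> av (Suc n)"
    using ins_in_av_iff[OF a] assms by (auto simp: avoiders_def)
  note av = avD[OF this]
  have bot: "asc_bot (map (shift a) \<tau>) = asc_bot \<tau>"
    using a less by (subst asc_bot_map) (auto simp: strict_mono_shift shift_0 shift_def)
  show ?thesis
  proof (cases "a = Suc n")
    case True
    hence "top_first (ins a \<tau>)" using top_first_ins[OF assms(1) a] by simp
    from asc_bot_top_first[OF this[unfolded ins_def]] show ?thesis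
      using True bot by (simp add: ins_def del: asc_bot.simps)
  next
    case False
    hence "\<not> top_first (ins a \<tau>)" using top_first_ins[OF assms(1) a] by simp
    from asc_bot_not_top_first[OF av(4,2)[unfolded ins_def] this[unfolded ins_def]] show ?thesis
      using False by (simp add: ins_def del: asc_bot.simps)
  qed
qed

text \<open>The factor by which prepending \<open>a\<close> to \<open>\<tau>\<close> of size \<open>n\<close> and kind \<open>\<kappa>\<close> changes the weight; \<open>new_max\<close> and
  \<open>old_max\<close> stand for \<open>a = n + 1\<close> and \<open>a = n\<close>.\<close>

definition head_wt :: "bool \<times> bool \<Rightarrow> bool \<Rightarrow> bool \<Rightarrow> coeffs" where
  "head_wt \<kappa> new_max old_max =
     (if new_max then vy * (if \<kappa> = (False, True) then 1 else vx3)
      else if fst \<kappa> then (if snd \<kappa> \<longrightarrow> old_max then vx1 else vx2)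
      else if snd \<kappa> then vy else vy * vx3)"

lemma top_first_perm:
  assumes "set (b # xs) = {1..n}" "distinct (b # xs)"
  shows "top_first (b # xs) \<longleftrightarrow> b = n"
proof
  assume "top_first (b # xs)"
  hence "\<forall>z\<in>{1..n}. z \<le> b" using assms(1) by (force simp: top_first_def)
  moreover have b: "b \<in> {1..n}" using assms(1) by force
  moreover have "n \<in> {1..n}" using b by simp
  ultimately show "b = n" by (meson atLeastAtMost_iff le_antisym)
next
  assume "b = n"
  thus "top_first (b # xs)"
    using assms by (auto simp: top_first_def set_eq_iff) (metis le_neq_implies_less)
qed

text \<open>By \<open>wt_Cons\<close> only the order of the first three letters matters. A letter
  \<open>b\<close> or \<open>c\<close> that is not maximal from its position on starts an increasing
  pair, hence is at most \<open>asc_bot \<tau>\<close> and lies below \<open>a\<close>. Maximal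
  letters are compared through their values.\<close>

lemma wt_ins:
  assumes "\<tau> \<in> av n" "2 \<le> n" "a \<in> {asc_bot \<tau><..Suc n}"
  shows "wt (ins a \<tau>) = head_wt (kind \<tau>) (a = Suc n) (a = n) * wt \<tau>"
proof -
  obtain b c xs where \<tau>: "\<tau> = b # c # xs"
    using avD(3)[OF assms(1)] assms(2) by (metis One_nat_def Suc_1 Suc_le_length_iff)
  note av = avD[OF assms(1), unfolded \<tau>]
  have bnds: "b \<in> {1..n}" "c \<in> {1..n}" "b \<noteq> c" using av(1,2) by force+
  have av': "avoids (c # xs) [1,2,3]" using av(4) avoids_123_Cons by blast
  have top: "top_first \<tau> \<longleftrightarrow> b = n" using top_first_perm av \<tau> by blast
  \<comment> \<open>The maximum of the tail is \<open>n - 1\<close> or \<open>n\<close>, depending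
    on whether \<open>b\<close> has taken the value \<open>n\<close>.\<close>
  have top': "top_first (c # xs) \<longleftrightarrow> c = (if b = n then n - 1 else n)"
  proof (cases "b = n")
    case True
    hence "set (c # xs) = {1..n} - {n}" using av(1,2) by auto
    moreover have "{1..n} - {n} = {1..n - 1}" by auto
    ultimately have "set (c # xs) = {1..n - 1}" by (rule trans)
    thus ?thesis using top_first_perm av(2) True by simp
  next
    case False
    have "n \<in> set (b # c # xs)" using av(1) assms(2) by simp
    hence "n \<in> set (c # xs)" using False by auto
    show ?thesis
    proof
      assume "top_first (c # xs)"
      thus "c = (if b = n then n - 1 else n)"
        using False bnds \<open>n \<in> set (c # xs)\<close> by (auto simp: top_first_def)
    next
      assume "c = (if b = n then n - 1 else n)"
      hence "c = n" using False by simp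
      moreover have "z \<le> n" "z \<noteq> c" if "z \<in> set xs" for z using that av(1,2) by auto
      ultimately show "top_first (c # xs)" by (auto simp: top_first_def le_neq_implies_less)
    qed
  qed
  have b_bot: "b = asc_bot \<tau>" if "b \<noteq> n"
    using asc_bot_not_top_first av that top \<tau> by metis
  have c_bot: "c = asc_bot (c # xs)" if "\<not> top_first (c # xs)"
    using asc_bot_not_top_first av' av(2) that by (metis distinct.simps(2))
  have c_bot': "c = asc_bot \<tau>" if "\<not> top_first (c # xs)" "b = n"
    using asc_bot_top_first[of b "c # xs"] c_bot that top \<tau> by simp
  have c_le: "c \<le> b" if "\<not> top_first (c # xs)"
    using av(4) c_bot[OF that] avoids_123_Cons[of b "c # xs"] by simp
  have "wt (ins a \<tau>) = wt (a # shift a b # shift a c # map (shift a) xs)"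
    by (simp add: ins_def \<tau>)
  also have "\<dots> =
     (if shift a b < a then vy else 1) * (if shift a c < a \<and> a < shift a b then vx1 else 1) *
     (if a < shift a c \<and> shift a c < shift a b then vx2 else 1) *
     (if shift a c < shift a b \<and> shift a b < a then vx3 else 1) * wt (map (shift a) \<tau>)"
    by (subst wt_Cons) (simp add: \<tau>)
  also have "wt (map (shift a) \<tau>) = wt \<tau>"
    by (rule wt_map_strict_mono[OF strict_mono_shift])
  also have "(shift a c < shift a b) = (c < b)"
    by (rule strict_mono_less[OF strict_mono_shift])
  finally have wt: "wt (ins a \<tau>) =
     (if shift a b < a then vy else 1) * (if shift a c < a \<and> a < shift a b then vx1 else 1) *
     (if a < shift a c \<and> c < b then vx2 else 1) *
     (if c < b \<and> shift a b < a then vx3 else 1) * wt \<tau>" .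
  have kind: "kind \<tau> = (b = n, top_first (c # xs))" by (simp add: kind_def top) (simp add: \<tau>)
  have a: "asc_bot \<tau> < a" "a \<le> Suc n" using assms(3) by auto
  have sh: "shift a b < a \<longleftrightarrow> b < a" "shift a c < a \<longleftrightarrow> c < a"
     "a < shift a b \<longleftrightarrow> a \<le> b" "a < shift a c \<longleftrightarrow> a \<le> c" by (auto simp: shift_def)
  show ?thesis
  proof (cases "b = n")
    case bn: True
    hence "c < b" using bnds by auto
    show ?thesis
    proof (cases "top_first (c # xs)")
      case True
      thus ?thesis using bn top' a bnds \<open>c < b\<close> unfolding wt kind sh head_wt_def by auto
    next
      case False
      thus ?thesis using bn c_bot' a bnds \<open>c < b\<close> unfolding wt kind sh head_wt_def by auto
    qed
  next
    case bn: False
    hence "b < a" "b < n" using b_bot a bnds by auto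
    show ?thesis
    proof (cases "top_first (c # xs)")
      case True
      thus ?thesis using bn top' a bnds \<open>b < a\<close> \<open>b < n\<close> unfolding wt kind sh head_wt_def by auto
    next
      case False
      hence "c < b" using c_le bnds by force
      thus ?thesis using bn False a bnds \<open>b < a\<close> unfolding wt kind sh head_wt_def by auto
    qed
  qed
qed

section \<open>Linear equations for the labelled series\<close>

text \<open>The sum of all \<open>fps_X ^ n * p n\<close>, written coefficientwise. The
  \<open>p n\<close> are themselves series because label weights will be powers of
  \<open>A0\<close>.\<close>

definition tsum :: "(nat \<Rightarrow> 'a::comm_ring_1 fps) \<Rightarrow> 'a fps" where
  "tsum p = Abs_fps (\<lambda>m. \<Sum>n\<le>m. p n $ (m - n))"

lemma tsum_add: "tsum (\<lambda>n. p n + q n) = tsum p + tsum q"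
  by (simp add: tsum_def fps_eq_iff sum.distrib)

lemma tsum_nth:
  assumes "m \<le> N"
  shows "tsum p $ m = (\<Sum>n\<le>N. fps_X ^ n * p n) $ m"
proof -
  have "(\<Sum>n\<le>N. fps_X ^ n * p n) $ m = (\<Sum>n\<le>N. if m < n then 0 else p n $ (m - n))"
    by (simp add: fps_sum_nth fps_X_power_mult_nth)
  also have "\<dots> = (\<Sum>n\<le>m. if m < n then 0 else p n $ (m - n))"
    using assms by (intro sum.mono_neutral_right) auto
  also have "\<dots> = tsum p $ m" by (auto simp: tsum_def intro!: sum.cong)
  finally show ?thesis ..
qed

lemma tsum_mult_left: "tsum (\<lambda>n. c * p n) = c * tsum p"
proof (rule fps_ext)
  fix m
  have "tsum (\<lambda>n. c * p n) $ m = (c * (\<Sum>n\<le>m. fps_X ^ n * p n)) $ m"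
    by (simp add: tsum_nth[of m m] sum_distrib_left mult.left_commute)
  also have "\<dots> = (c * tsum p) $ m"
    unfolding fps_mult_nth by (intro sum.cong refl) (simp add: tsum_nth[of _ m])
  finally show "tsum (\<lambda>n. c * p n) $ m = (c * tsum p) $ m" .
qed

lemma tsum_Suc: "tsum p = p 0 + fps_X * tsum (\<lambda>n. p (Suc n))"
proof (rule fps_ext)
  fix m show "tsum p $ m = (p 0 + fps_X * tsum (\<lambda>n. p (Suc n))) $ m"
    by (cases m) (simp_all add: tsum_def sum.atMost_Suc_shift del: sum.atMost_Suc)
qed

lemma tsum_const_nth: "tsum (\<lambda>n. fps_const (c n)) = Abs_fps c"
proof (rule fps_ext)
  fix m
  have "tsum (\<lambda>n. fps_const (c n)) $ m = (\<Sum>n\<le>m. if n = m then c m else 0)"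
    unfolding tsum_def fps_nth_Abs_fps by (intro sum.cong) auto
  thus "tsum (\<lambda>n. fps_const (c n)) $ m = Abs_fps c $ m" by simp
qed

definition level :: "bool \<times> bool \<Rightarrow> (nat \<Rightarrow> coeffs fps) \<Rightarrow> nat \<Rightarrow> coeffs fps" where
  "level \<kappa> f n = (\<Sum>\<tau>\<in>av n. if kind \<tau> = \<kappa> then fps_const (wt \<tau>) * f (n - asc_bot \<tau>) else 0)"

definition psum :: "(nat \<Rightarrow> coeffs fps) \<Rightarrow> nat \<Rightarrow> coeffs fps" where
  "psum f k = (\<Sum>j=1..k. f j)"

text \<open>The children of \<tau> listed by label: \<open>a = n + 1\<close> raises it by one,
  \<open>a = n + 1 - j\<close> gives label \<open>j\<close>, and \<open>a = n\<close> is the case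
  \<open>j = 1\<close>. The bound on \<open>n\<close> is that of \<open>wt_ins\<close>.\<close>

lemma level_Suc:
  assumes "2 \<le> n"
  shows "level (p, q) f (Suc n) = (\<Sum>\<tau>\<in>av n. if top_first \<tau> = q then fps_const (wt \<tau>) *
     (if p then fps_const (head_wt (kind \<tau>) True False) * f (Suc (n - asc_bot \<tau>))
      else \<Sum>j=1..n - asc_bot \<tau>. fps_const (head_wt (kind \<tau>) False (j = 1)) * f j) else 0)"
  unfolding level_def sum_av_Suc
proof (rule sum.cong[OF refl])
  fix \<tau> assume \<tau>: "\<tau> \<in> av n"
  let ?b = "asc_bot \<tau>"
  let ?g = "\<lambda>a. if kind (ins a \<tau>) = (p, q) then
      fps_const (wt (ins a \<tau>)) * f (Suc n - asc_bot (ins a \<tau>)) else 0"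
  have b: "?b \<le> n" using asc_bot_le[OF \<tau>] .
  have kind: "kind (ins a \<tau>) = (a = Suc n, top_first \<tau>)" if "a \<in> {?b<..Suc n}" for a
    using that by (intro kind_ins[OF \<tau>]) auto
  have last_iff: "Suc n - a = 1 \<longleftrightarrow> a = n" if "a \<le> n" for a
    using that by auto
  note simps = kind asc_bot_ins[OF \<tau>] wt_ins[OF \<tau> assms]
  have "{?b<..Suc n} = insert (Suc n) {?b<..n}" using b by auto
  hence "(\<Sum>a\<in>{?b<..Suc n}. ?g a) = ?g (Suc n) + (\<Sum>a\<in>{?b<..n}. ?g a)" by simp
  also have "?g (Suc n) = (if top_first \<tau> = q \<and> p then
      fps_const (wt \<tau>) * (fps_const (head_wt (kind \<tau>) True False) * f (Suc (n - ?b))) else 0)"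
    using b by (simp add: simps Suc_diff_le mult_ac flip: fps_const_mult)
  also have "(\<Sum>a\<in>{?b<..n}. ?g a) = (\<Sum>a\<in>{?b<..n}. if top_first \<tau> = q \<and> \<not> p then
      fps_const (wt \<tau>) * (fps_const (head_wt (kind \<tau>) False (a = n)) * f (Suc n - a)) else 0)"
    by (intro sum.cong refl) (auto simp: simps mult_ac simp flip: fps_const_mult)
  also have "\<dots> = (\<Sum>j=1..n - ?b. if top_first \<tau> = q \<and> \<not> p then
      fps_const (wt \<tau>) * (fps_const (head_wt (kind \<tau>) False (j = 1)) * f j) else 0)"
    using b by (intro sum.reindex_bij_witness[of _ "\<lambda>j. Suc n - j" "\<lambda>a. Suc n - a"])
      (auto simp: last_iff)
  finally show "(\<Sum>a\<in>{?b<..Suc n}. ?g a) = (if top_first \<tau> = q then fps_const (wt \<tau>) *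
     (if p then fps_const (head_wt (kind \<tau>) True False) * f (Suc (n - ?b))
      else \<Sum>j=1..n - ?b. fps_const (head_wt (kind \<tau>) False (j = 1)) * f j) else 0)"
    by (simp add: sum_distrib_left)
qed

text \<open>The second bit of a child is the first bit of its parent, so each kind collects two
  parent kinds. Only parents of kind \<open>(True, True)\<close> treat \<open>j = 1\<close>
  separately, which gives the mixed term in \<open>X1\<close> and \<open>X2\<close>.\<close>

lemma level_recurrences:
  assumes "2 \<le> n"
  shows "level (True, True) f (Suc n)
      = Y * X3 * (level (True, True) (\<lambda>k. f (Suc k)) n + level (True, False) (\<lambda>k. f (Suc k)) n)"
    and "level (True, False) f (Suc n)
      = Y * level (False, True) (\<lambda>k. f (Suc k)) n + Y * X3 * level (False, False) (\<lambda>k. f (Suc k)) n"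
    and "level (False, True) f (Suc n)
      = X1 * level (True, False) (psum f) n + level (True, True) (\<lambda>k. X1 * f 1 + X2 * (psum f k - f 1)) n"
    and "level (False, False) f (Suc n)
      = Y * level (False, True) (psum f) n + Y * X3 * level (False, False) (psum f) n"
proof -
  have kind: "kind \<tau> = (p, q) \<longleftrightarrow> top_first \<tau> = p \<and> top_first (tl \<tau>) = q" for \<tau> p q
    by (auto simp: kind_def)
  \<comment> \<open>Splitting off \<open>j = 1\<close> needs a nonempty range; labels of nonempty
    avoiders are positive.\<close>
  have "(\<Sum>j=1..k. fps_const (if j = 1 then vx1 else vx2) * f j) = X1 * f 1 + X2 * (psum f k - f 1)"
    if "1 \<le> k" for k
  proof -
    have "(\<Sum>j=1..k. fps_const (if j = 1 then vx1 else vx2) * f j)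
        = X1 * f 1 + (\<Sum>j=Suc 1..k. fps_const (if j = 1 then vx1 else vx2) * f j)"
      using that by (subst sum.atLeast_Suc_atMost) auto
    also have "(\<Sum>j=Suc 1..k. fps_const (if j = 1 then vx1 else vx2) * f j) = (\<Sum>j=Suc 1..k. X2 * f j)"
      by (intro sum.cong) auto
    also have "\<dots> = X2 * (psum f k - f 1)"
      using that by (simp add: psum_def sum.atLeast_Suc_atMost[of 1 k] sum_distrib_left)
    finally show ?thesis .
  qed
  hence mixed: "(\<Sum>j=1..n - asc_bot \<tau>. fps_const (if j = 1 then vx1 else vx2) * f j)
      = X1 * f 1 + X2 * (psum f (n - asc_bot \<tau>) - f 1)" if "\<tau> \<in> av n" for \<tau>
    using asc_bot_less[OF that] assms by simp
  show "level (True, True) f (Suc n)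
      = Y * X3 * (level (True, True) (\<lambda>k. f (Suc k)) n + level (True, False) (\<lambda>k. f (Suc k)) n)"
    unfolding level_Suc[OF assms] unfolding level_def sum_distrib_left sum.distrib[symmetric]
    by (intro sum.cong refl) (auto simp: kind head_wt_def kind_def mult_ac simp flip: fps_const_mult)
  show "level (True, False) f (Suc n)
      = Y * level (False, True) (\<lambda>k. f (Suc k)) n + Y * X3 * level (False, False) (\<lambda>k. f (Suc k)) n"
    unfolding level_Suc[OF assms] unfolding level_def sum_distrib_left sum.distrib[symmetric]
    by (intro sum.cong refl) (auto simp: kind head_wt_def kind_def mult_ac simp flip: fps_const_mult)
  show "level (False, True) f (Suc n)
      = X1 * level (True, False) (psum f) n + level (True, True) (\<lambda>k. X1 * f 1 + X2 * (psum f k - f 1)) n"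
    unfolding level_Suc[OF assms] unfolding level_def sum_distrib_left sum.distrib[symmetric]
  proof (intro sum.cong refl, goal_cases)
    case (1 \<tau>)
    show ?case
    proof (cases "top_first \<tau> \<and> top_first (tl \<tau>)")
      case True
      thus ?thesis using mixed[OF 1] by (simp add: kind head_wt_def kind_def)
    next
      case False
      thus ?thesis by (auto simp: kind head_wt_def kind_def psum_def mult_ac simp flip: sum_distrib_left)
    qed
  qed
  show "level (False, False) f (Suc n)
      = Y * level (False, True) (psum f) n + Y * X3 * level (False, False) (psum f) n"
    unfolding level_Suc[OF assms] unfolding level_def sum_distrib_left sum.distrib[symmetric]
    by (intro sum.cong refl)
      (auto simp: kind head_wt_def kind_def mult_ac psum_def simp flip: fps_const_mult sum_distrib_left)
qed

text \<open>Sizes 0 and 1 are left out, since the weight recursion starts from two letters.\<close>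

definition gf :: "bool \<times> bool \<Rightarrow> (nat \<Rightarrow> coeffs fps) \<Rightarrow> coeffs fps" where
  "gf \<kappa> f = T^2 * tsum (\<lambda>n. level \<kappa> f (Suc (Suc n)))"

lemma level_add: "level \<kappa> (\<lambda>k. f k + g k) n = level \<kappa> f n + level \<kappa> g n"
  unfolding level_def sum.distrib[symmetric] by (intro sum.cong) (auto simp: distrib_left)

lemma level_mult_left: "level \<kappa> (\<lambda>k. c * f k) n = c * level \<kappa> f n"
  unfolding level_def sum_distrib_left by (intro sum.cong) (auto simp: mult.left_commute)

lemma gf_add: "gf \<kappa> (\<lambda>k. f k + g k) = gf \<kappa> f + gf \<kappa> g"
  by (simp add: gf_def level_add tsum_add distrib_left)

lemma gf_mult_left: "gf \<kappa> (\<lambda>k. c * f k) = c * gf \<kappa> f"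
  by (simp add: gf_def level_mult_left tsum_mult_left mult.left_commute)

lemma gf_Suc:
  "gf \<kappa> f = T^2 * level \<kappa> f 2 + T * (T^2 * tsum (\<lambda>n. level \<kappa> f (Suc (Suc (Suc n)))))"
  unfolding gf_def by (subst tsum_Suc) (simp add: distrib_left mult.left_commute numeral_2_eq_2)

lemma sum_av_1: "(\<Sum>\<sigma>\<in>av (Suc 0). g \<sigma>) = g [1]"
proof -
  have "{0<..Suc 0} = {1}" by auto
  thus ?thesis unfolding sum_av_Suc av_0 by (simp add: ins_def)
qed

lemma sum_av_2: "(\<Sum>\<sigma>\<in>av 2. g \<sigma>) = g [1, 2] + g [2, 1]"
proof -
  have "(\<Sum>\<sigma>\<in>av 2. g \<sigma>) = (\<Sum>a\<in>{0<..2}. g (ins a [1]))"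
    unfolding sum_av_Suc[of _ "Suc 0", folded numeral_2_eq_2] sum_av_1 by simp
  also have "{0<..2} = {1, 2::nat}" by auto
  also have "(\<Sum>a\<in>{1, 2}. g (ins a [1])) = g [1, 2] + g [2, 1]"
    by (simp add: ins_def shift_def)
  finally show ?thesis .
qed

text \<open>\<open>[2, 1]\<close> has label 2 and weight \<open>vy\<close>; \<open>[1, 2]\<close>
  has label 1 and weight 1.\<close>

lemma level_2:
  "level \<kappa> f 2 = (if \<kappa> = (True, True) then Y * f 2 else if \<kappa> = (False, True) then f 1 else 0)"
  unfolding level_def sum_av_2 by (auto simp: kind_def top_first_def wt_pair One_nat_def)

lemma gf_equations:
  "gf (True, True) f = T^2 * Y * f 2
     + T * X3 * Y * (gf (True, True) (\<lambda>k. f (Suc k)) + gf (True, False) (\<lambda>k. f (Suc k)))"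
  "gf (True, False) f
     = T * Y * (gf (False, True) (\<lambda>k. f (Suc k)) + X3 * gf (False, False) (\<lambda>k. f (Suc k)))"
  "gf (False, True) f = T^2 * f 1 + T * (X1 * gf (True, False) (psum f)
     + (X1 - X2) * f 1 * gf (True, True) (\<lambda>_. 1) + X2 * gf (True, True) (psum f))"
  "gf (False, False) f = T * Y * (gf (False, True) (psum f) + X3 * gf (False, False) (psum f))"
proof -
  note simps = level_2 level_recurrences tsum_add tsum_mult_left
  show "gf (True, True) f = T^2 * Y * f 2
     + T * X3 * Y * (gf (True, True) (\<lambda>k. f (Suc k)) + gf (True, False) (\<lambda>k. f (Suc k)))"
    unfolding gf_Suc[of _ f] by (simp add: simps gf_def algebra_simps)
  show "gf (True, False) f
     = T * Y * (gf (False, True) (\<lambda>k. f (Suc k)) + X3 * gf (False, False) (\<lambda>k. f (Suc k)))"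
    unfolding gf_Suc[of _ f] by (simp add: simps gf_def algebra_simps)
  show "gf (False, False) f = T * Y * (gf (False, True) (psum f) + X3 * gf (False, False) (psum f))"
    unfolding gf_Suc[of _ f] by (simp add: simps gf_def algebra_simps)
  have "gf (False, True) f = T^2 * f 1 + T * (X1 * gf (True, False) (psum f)
      + gf (True, True) (\<lambda>k. X1 * f 1 + X2 * (psum f k - f 1)))"
    unfolding gf_Suc[of _ f] by (simp add: simps gf_def algebra_simps)
  also have "(\<lambda>k. X1 * f 1 + X2 * (psum f k - f 1)) = (\<lambda>k. (X1 - X2) * f 1 * 1 + X2 * psum f k)"
    by (rule ext) algebra
  finally show "gf (False, True) f = T^2 * f 1 + T * (X1 * gf (True, False) (psum f)
     + (X1 - X2) * f 1 * gf (True, True) (\<lambda>_. 1) + X2 * gf (True, True) (psum f))"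
    unfolding gf_add gf_mult_left by (simp add: add.assoc)
qed

lemma A_series_eq:
  "A_series = 1 + T + gf (True, True) (\<lambda>_. 1) + gf (True, False) (\<lambda>_. 1)
     + gf (False, True) (\<lambda>_. 1) + gf (False, False) (\<lambda>_. 1)"
proof -
  let ?W = "\<lambda>n. \<Sum>\<sigma>\<in>av n. wt \<sigma>"
  have W: "fps_const (?W n) = level (True, True) (\<lambda>_. 1) n + level (True, False) (\<lambda>_. 1) n
      + level (False, True) (\<lambda>_. 1) n + level (False, False) (\<lambda>_. 1) n" for n
  proof -
    have "fps_const (?W n) = (\<Sum>\<sigma>\<in>av n. fps_const (wt \<sigma>))"
      by (rule fps_ext) (simp add: fps_sum_nth)
    also have "\<dots> = level (True, True) (\<lambda>_. 1) n + level (True, False) (\<lambda>_. 1) n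
      + level (False, True) (\<lambda>_. 1) n + level (False, False) (\<lambda>_. 1) n"
      unfolding level_def sum.distrib[symmetric] by (intro sum.cong refl) (auto simp: kind_def)
    finally show ?thesis .
  qed
  have "A_series = tsum (\<lambda>n. fps_const (?W n))"
    unfolding tsum_const_nth A_series_def wt_def ..
  also have "\<dots> = fps_const (?W 0) + T * (fps_const (?W (Suc 0))
      + T * tsum (\<lambda>n. fps_const (?W (Suc (Suc n)))))"
    by (subst tsum_Suc, subst tsum_Suc) simp
  also have "\<dots> = 1 + T + T^2 * tsum (\<lambda>n. fps_const (?W (Suc (Suc n))))"
    unfolding sum_av_1 av_0 by (simp add: algebra_simps power2_eq_square)
  also have "T^2 * tsum (\<lambda>n. fps_const (?W (Suc (Suc n)))) = gf (True, True) (\<lambda>_. 1)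
      + gf (True, False) (\<lambda>_. 1) + gf (False, True) (\<lambda>_. 1) + gf (False, False) (\<lambda>_. 1)"
    unfolding W gf_def tsum_add by (simp add: distrib_left)
  finally show ?thesis by (simp add: add.assoc)
qed

section \<open>The kernel method\<close>

text \<open>The names \<open>MM\<close>, \<open>ML\<close>, \<open>LM\<close>, \<open>LL\<close> stand for the series of kind \<open>(True, True)\<close>, \<open>(True, False)\<close>,
  \<open>(False, True)\<close>, \<open>(False, False)\<close>, and the suffixes \<open>1\<close>, \<open>k\<close>, \<open>U\<close> for the weights \<open>1\<close>, \<open>k\<close>, \<open>U ^ k\<close> of the
  label \<open>k\<close>. The kernel equation removes the series with suffix \<open>U\<close> and leaves the linear equation
  \<open>d1 * ML1 = n1\<close>; the other equations express \<open>A\<close> through \<open>ML1\<close>.\<close>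

lemma elimination:
  fixes t y x1 x2 x3 U :: "'a::idom"
  assumes MM1: "MM1 = t^2 * y + t * x3 * y * (MM1 + ML1)"
    and ML1: "ML1 = t * y * (LM1 + x3 * LL1)"
    and LM1: "LM1 = t^2 + t * (x1 * MLk + x1 * MM1 + x2 * (MMk - MM1))"
    and LL1: "LL1 = t * y * (LMk + x3 * LLk)"
    and MMk: "MMk = 2 * t^2 * y + t * x3 * y * (MMk + MM1 + MLk + ML1)"
    and MLk: "MLk = t * y * (LMk + LM1 + x3 * (LLk + LL1))"
    and MMU: "MMU = t^2 * y * U^2 + t * x3 * y * U * (MMU + MLU)"
    and MLU: "MLU = t * y * U * (LMU + x3 * LLU)"
    and LMU: "(U - 1) * LMU = (U - 1) * t^2 * U + t * x1 * U * (MLU - ML1)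
      + t * x2 * U * (MMU - MM1) + t * (x1 - x2) * U * (U - 1) * MM1"
    and LLU: "(U - 1) * LLU = t * y * U * (LMU - LM1 + x3 * (LLU - LL1))"
    and kernel: "(1 - t * y * x3 * U) * (U - 1 - t * y * x3 * U - t^2 * x1 * y * U^2)
      = t^3 * x2 * x3 * y^2 * U^3"
    and A: "A = 1 + t + MM1 + ML1 + LM1 + LL1"
    and nz: "t \<noteq> 0" "y \<noteq> 0" "U \<noteq> 0" "x3 \<noteq> 0" "1 - t * y * x3 \<noteq> 0" "1 - t * y * x3 * U \<noteq> 0"
      "t^2 * y * (x1 - x2) * x3 * U - (1 - t * y * x3) * x3 - t * x1 \<noteq> 0"
      "(1 - t * y * x3) * (x3 + t * x1) + t^2 * x2 * y * x3 \<noteq> 0"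
  shows "A * D_expr x1 x2 x3 y t U = N_expr x1 x2 x3 y t U"
proof -
  \<comment> \<open>\<open>d1\<close> and \<open>n1\<close> come from the kernel equation.
    \<open>t * y * r * d2\<close> is the coefficient of \<open>LL1\<close> after \<open>LM1\<close>,
    \<open>MM1\<close> and \<open>MMk\<close> are eliminated; \<open>f1\<close> and
    \<open>f0\<close> then express this multiple of \<open>A\<close> as an affine function of
    \<open>ML1\<close>.\<close>
  define r where "r = 1 - t * y * x3"
  define q where "q = t * y * x3 * U"
  define d1 where "d1 = y * x3 * U * (t^2 * y * (x1 - x2) * x3 * U - r * x3 - t * x1)"
  define n1 where "n1 = - (r * (U - 1 - q - t^2 * x1 * y * U^2)
      + y * x3 * U * (U - 1) * (t * (x1 - x2) * (t^2 * y) + t^2 * r) - t * x2 * (y * x3 * U) * (t^2 * y))"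
  define d2 where "d2 = r * (x3 + t * x1) + t^2 * x2 * y * x3"
  define f1 where "f1 = t^2 * y^2 * x3 * d2 + (t * y * r + r) * d2 + (1 - x3) * (r^2 - t * y * (t * x1 * r^2
      + t * (x1 - x2) * r * (t * y * x3) + t * x2 * ((t * y * x3)^2 + 2 * r * (t * y * x3))))"
  define f0 where "f0 = t * y * r * (1 + t) * d2 + t^3 * y^2 * d2
      - (1 - x3) * t * y * (t * (x1 - x2) * r * t^2 * y
      + t * x2 * (t * y * x3 * t^2 * y + 2 * r * t^2 * y) + t^2 * r^2)"
  have MM1': "r * MM1 = t * y * x3 * ML1 + t^2 * y"
    using MM1 unfolding r_def by algebra
  \<comment> \<open>The right-hand side of \<open>MLk\<close> splits into those of
    \<open>LL1\<close> and \<open>ML1\<close>, which removes \<open>LMk\<close> and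
    \<open>LLk\<close>.\<close>
  have MLk': "MLk = LL1 + ML1"
    using MLk ML1 LL1 by algebra
  have MMk': "r * MMk = t * y * x3 * (MM1 + LL1 + 2 * ML1) + 2 * t^2 * y"
    using MMk MLk' unfolding r_def by algebra
  have "d1 * ML1 = n1"
  proof -
    \<comment> \<open>All series with suffix \<open>U\<close> except \<open>MLU\<close> are
      eliminated. By the kernel the coefficients of \<open>MLU\<close> on both sides agree, and
      \<open>?E\<close> is what remains, up to the factor \<open>t * y * U * U\<close>.\<close>
    let ?E = "t * x2 * (t^2 * y * U^2 - (1 - q) * MM1) - (1 - q) * (t * x1 + x3) * ML1
      + (1 - q) * (U - 1) * (t * (x1 - x2) * MM1 + t^2)"
    have MMU': "(1 - q) * MMU = q * MLU + t^2 * y * U^2"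
      using MMU unfolding q_def by algebra
    have LLU': "(U - 1) * LLU = MLU - U * ML1"
      using LLU MLU ML1 by algebra
    have MLU': "(U - 1) * MLU = t * y * U * ((U - 1) * LMU + x3 * ((U - 1) * LLU))"
      using MLU by algebra
    have "(1 - q) * (U - 1) * MLU = t * y * U * ((1 - q) * ((U - 1) * t^2 * U + t * x1 * U * (MLU - ML1)
        - t * x2 * U * MM1 + t * (x1 - x2) * U * (U - 1) * MM1)
        + t * x2 * U * (q * MLU + t^2 * y * U^2) + (1 - q) * x3 * (MLU - U * ML1))"
      (is "_ = ?R")
      using MLU' unfolding LMU LLU' MMU'[symmetric] by algebra
    moreover have "(1 - q) * (U - 1) * MLU
        = (q * (1 - q) + t^2 * x1 * y * U^2 * (1 - q) + t^3 * x2 * x3 * y^2 * U^3) * MLU"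
      (is "_ = ?R'")
    proof -
      have "(1 - q) * (U - 1) = q * (1 - q) + t^2 * x1 * y * U^2 * (1 - q) + t^3 * x2 * x3 * y^2 * U^3"
        using kernel unfolding q_def by algebra
      thus ?thesis by simp
    qed
    moreover have "t * y * U * U * ?E = ?R - ?R'"
      unfolding q_def by algebra
    ultimately have "t * y * U * U * ?E = 0" by simp
    hence "?E = 0" using nz by simp
    \<comment> \<open>Multiplied by \<open>y * x3 * U\<close>, the term of \<open>?E\<close> without
      the factor \<open>1 - q\<close> becomes the right-hand side of the kernel equation, which has
      that factor; so \<open>1 - q\<close> cancels.\<close>
    moreover have "(1 - q) * (y * x3 * U * (U - 1) * (t * (x1 - x2) * MM1 + t^2) - y * x3 * U * (t * x1 + x3) * ML1
        - t * x2 * (y * x3 * U) * MM1 + (U - 1 - q - t^2 * x1 * y * U^2)) = y * x3 * U * ?E"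
      using kernel unfolding q_def by algebra
    ultimately have "y * x3 * U * (U - 1) * (t * (x1 - x2) * MM1 + t^2) - y * x3 * U * (t * x1 + x3) * ML1
        - t * x2 * (y * x3 * U) * MM1 + (U - 1 - q - t^2 * x1 * y * U^2) = 0"
      using nz by (simp add: q_def)
    thus ?thesis
      using MM1' unfolding d1_def n1_def q_def r_def by algebra
  qed
  moreover have "t * y * r * d2 * A = f1 * ML1 + f0"
  proof -
    \<comment> \<open>Multiplying by \<open>r\<close> twice clears the denominators of
      \<open>MMk\<close> and of the \<open>MM1\<close> inside it.\<close>
    have "r * LM1 = t^2 * r + t * x1 * r * (LL1 + ML1) + t * (x1 - x2) * (r * MM1) + t * x2 * (r * MMk)"
      using LM1 MLk' by algebra
    hence "r^2 * LM1 = t^2 * r^2 + t * x1 * r^2 * (LL1 + ML1) + t * (x1 - x2) * r * (t * y * x3 * ML1 + t^2 * y)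
        + t * x2 * (t * y * x3 * ((t * y * x3 * ML1 + t^2 * y) + r * LL1 + 2 * r * ML1) + 2 * r * t^2 * y)"
      using MM1' MMk' by algebra
    hence LL1': "t * y * r * d2 * LL1 = r^2 * ML1 - t * y * (t^2 * r^2 + t * x1 * r^2 * ML1
        + t * (x1 - x2) * r * (t * y * x3 * ML1 + t^2 * y)
        + t * x2 * (t * y * x3 * ((t * y * x3 * ML1 + t^2 * y) + 2 * r * ML1) + 2 * r * t^2 * y))"
      using ML1 unfolding d2_def by algebra
    \<comment> \<open>\<open>LM1\<close> is replaced through the equation for \<open>ML1\<close>,
      hence the factor \<open>1 - x3\<close> on \<open>LL1\<close>.\<close>
    have "t * y * r * A = t * y * r * (1 + t) + t * y * (t * y * x3 * ML1 + t^2 * y) + t * y * r * ML1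
        + r * ML1 + (1 - x3) * (t * y * r * LL1)"
      using A ML1 MM1' by algebra
    hence "t * y * r * d2 * A = d2 * (t * y * r * (1 + t) + t * y * (t * y * x3 * ML1 + t^2 * y) + t * y * r * ML1
        + r * ML1) + (1 - x3) * (t * y * r * d2 * LL1)"
      by algebra
    thus ?thesis
      unfolding LL1' f1_def f0_def by algebra
  qed
  \<comment> \<open>The quotient found by elimination, cross-multiplied with the claimed one: a
    polynomial identity modulo the kernel relation.\<close>
  moreover have "D_expr x1 x2 x3 y t U * (f1 * n1 + f0 * d1)
      = d1 * (t * y * r * d2) * N_expr x1 x2 x3 y t U"
    using kernel
    unfolding f1_def f0_def n1_def d1_def d2_def r_def q_def D_expr_def N_expr_def by algebra
  moreover have "d1 * c * (A * D - N) = D * (f1 * (d1 * ML1) + f0 * d1) - d1 * c * N"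
    if "c * A = f1 * ML1 + f0" for c D N
    using that by algebra
  ultimately have "d1 * (t * y * r * d2) * (A * D_expr x1 x2 x3 y t U - N_expr x1 x2 x3 y t U) = 0"
    by simp
  moreover have "d1 * (t * y * r * d2) \<noteq> 0"
    using nz by (simp add: d1_def d2_def r_def)
  ultimately show ?thesis by simp
qed

section \<open>Specialising the kernel method to \<open>A0\<close>\<close>

lemma A0_nth_0: "A0 $ 0 = 1"
proof -
  have "A0 $ 0 = step A0 $ 0" using A0_equation_A0 A0_equation_iff by metis
  thus ?thesis by (simp add: step_def)
qed

lemma A0_kernel:
  "(1 - T * Y * X3 * A0) * (A0 - 1 - T * Y * X3 * A0 - T^2 * X1 * Y * A0^2) = T^3 * X2 * X3 * Y^2 * A0^3"
proof -
  have "A0 = step A0" using A0_equation_A0 A0_equation_iff by blast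
  hence "A0 - 1 - T * Y * X3 * A0 - T^2 * X1 * Y * A0^2 = T^3 * X2 * X3 * Y^2 * A0^3 * geom A0"
    unfolding step_def by algebra
  thus ?thesis using geom[of A0] by algebra
qed

text \<open>Weight 1 thus leads to weight \<open>k\<close>, which is how the latter enters the
  system.\<close>

lemma psum_1: "psum (\<lambda>_. 1) = of_nat"
  by (simp add: psum_def fun_eq_iff)

text \<open>Geometric summation. The factor \<open>U - 1\<close> is kept because for
  \<open>U = A0\<close> its constant term vanishes, so it is not invertible.\<close>

lemma gf_psum_power:
  "(U - 1) * gf \<kappa> (psum (\<lambda>k. U ^ k)) = U * (gf \<kappa> (\<lambda>k. U ^ k) - gf \<kappa> (\<lambda>_. 1))"
proof -
  have "(U - 1) * psum (\<lambda>k. U ^ k) k = U * U ^ k + (- U) * 1" for k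
    by (induction k) (simp_all add: psum_def algebra_simps)
  hence "gf \<kappa> (\<lambda>k. (U - 1) * psum (\<lambda>k. U ^ k) k) = gf \<kappa> (\<lambda>k. U * U ^ k + (- U) * 1)" by simp
  thus ?thesis unfolding gf_add gf_mult_left by (simp add: algebra_simps)
qed

lemma indeterminates: "vy \<noteq> 0" "vx3 \<noteq> 0" "vx1 \<noteq> vx2"
  by (simp_all add: vy_def vx3_def vx1_def vx2_def)

lemma fps_nonzeroI: "f $ 0 \<noteq> 0 \<Longrightarrow> f \<noteq> 0"
  by auto

lemma A_series_times_D: "A_series * D_expr X1 X2 X3 Y T A0 = N_expr X1 X2 X3 Y T A0"
proof (rule elimination)
  let ?G = "\<lambda>p q f. gf (p, q) f"
  let ?one = "\<lambda>_::nat. 1 :: coeffs fps"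
  let ?pow = "\<lambda>k. A0 ^ k"
  have Suc_of_nat: "?G p q (\<lambda>k. of_nat (Suc k)) = ?G p q of_nat + ?G p q ?one" for p q
    using gf_add[of "(p, q)" of_nat ?one] by (simp add: add.commute)
  have Suc_pow: "?G p q (\<lambda>k. A0 ^ Suc k) = A0 * ?G p q ?pow" for p q
    by (simp add: gf_mult_left)
  show "?G True True ?one = T^2 * Y + T * X3 * Y * (?G True True ?one + ?G True False ?one)"
    by (subst gf_equations(1)) simp
  show "?G True False ?one = T * Y * (?G False True ?one + X3 * ?G False False ?one)"
    by (subst gf_equations(2)) simp
  show "?G False True ?one = T^2 + T * (X1 * ?G True False of_nat + X1 * ?G True True ?one
      + X2 * (?G True True of_nat - ?G True True ?one))"
    by (subst gf_equations(3)) (simp only: psum_1, algebra)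
  show "?G False False ?one = T * Y * (?G False True of_nat + X3 * ?G False False of_nat)"
    by (subst gf_equations(4)) (simp add: psum_1)
  show "?G True True of_nat = 2 * T^2 * Y + T * X3 * Y * (?G True True of_nat + ?G True True ?one
      + ?G True False of_nat + ?G True False ?one)"
    by (subst gf_equations(1)) (simp add: Suc_of_nat algebra_simps del: of_nat_Suc)
  show "?G True False of_nat = T * Y * (?G False True of_nat + ?G False True ?one
      + X3 * (?G False False of_nat + ?G False False ?one))"
    by (subst gf_equations(2)) (simp add: Suc_of_nat del: of_nat_Suc)
  show "?G True True ?pow = T^2 * Y * A0^2 + T * X3 * Y * A0 * (?G True True ?pow + ?G True False ?pow)"
    by (subst gf_equations(1)) (simp only: Suc_pow, simp add: algebra_simps)
  show "?G True False ?pow = T * Y * A0 * (?G False True ?pow + X3 * ?G False False ?pow)"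
    by (subst gf_equations(2)) (simp only: Suc_pow, simp add: algebra_simps)
  show "(A0 - 1) * ?G False True ?pow = (A0 - 1) * T^2 * A0
      + T * X1 * A0 * (?G True False ?pow - ?G True False ?one)
      + T * X2 * A0 * (?G True True ?pow - ?G True True ?one)
      + T * (X1 - X2) * A0 * (A0 - 1) * ?G True True ?one"
    using gf_equations(3)[of ?pow] gf_psum_power[of A0 "(True, False)"] gf_psum_power[of A0 "(True, True)"]
    unfolding power_one_right by algebra
  show "(A0 - 1) * ?G False False ?pow = T * Y * A0 * (?G False True ?pow - ?G False True ?one
      + X3 * (?G False False ?pow - ?G False False ?one))"
    using gf_equations(4)[of ?pow] gf_psum_power[of A0 "(False, True)"] gf_psum_power[of A0 "(False, False)"]
    by algebra
  show "(1 - T * Y * X3 * A0) * (A0 - 1 - T * Y * X3 * A0 - T^2 * X1 * Y * A0^2) = T^3 * X2 * X3 * Y^2 * A0^3"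
    by (rule A0_kernel)
  show "A_series = 1 + T + ?G True True ?one + ?G True False ?one + ?G False True ?one + ?G False False ?one"
    by (rule A_series_eq)
\<comment> \<open>Except for \<open>T\<close>, each quantity required to be nonzero has a nonzero
  constant term.\<close>
qed ((rule fps_nonzeroI, use indeterminates A0_nth_0 in \<open>simp; fail\<close>) | simp)+

theorem theorem7:
  shows "to_fract A_series
       = to_fract (N_expr X1 X2 X3 Y T A0) / to_fract (D_expr X1 X2 X3 Y T A0)"
proof -
  \<comment> \<open>The constant term is \<open>- vx3 * (vx1 - vx2)\<close>.\<close>
  have "D_expr X1 X2 X3 Y T A0 $ 0 \<noteq> 0"
    using indeterminates by (simp add: D_expr_def)
  hence "to_fract (D_expr X1 X2 X3 Y T A0) \<noteq> 0"
    using fps_nonzeroI by fastforce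
  thus ?thesis
    by (simp add: eq_divide_eq flip: A_series_times_D)
qed

end
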